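(* The free product on $q$-matroids is associative: for all $q$-matroids $M_1,M_2,M_3$ with ground spaces $E_1,E_2,E_3$ over $\mathbb{F}_q$, under the canonical identification of $(E_1\oplus E_2)\oplus E_3$ with $E_1\oplus(E_2\oplus E_3)$ one has $(M_1\square M_2)\square M_3= M_1\square(M_2\square M_3)$.
   Context: For a finite-dimensional $\mathbb{F}_q$-space $E$, $\mathcal{L}(E)$ is its subspace lattice. A $q$-matroid $M=(E,r)$ is given by $r:\mathcal{L}(E)\to\mathbb{Z}$ with (R1) $0\le r(A)\le\dim(A)$; (R2) $A\le B\Rightarrow r(A)\le r(B)$; (R3) $r(A+B)+r(A\cap B)\le r(A)+r(B)$. $A$ is independent if $r(A)=\dim A$. Free product: for $q$-matroids $M_i=(E_i,r_i)$, $i=1,2$, with projections $\pi_i:E_1\oplus E_2\to E_i$ and embeddings $\iota_i:E_i\to E_1\oplus E_2$, put $\lambda_1(A)=r_1(E_1)-r_1(A)$ and $\nu_2(B)=\dim(B)-r_2(B)$. $M_1\square M_2$ is the $q$-matroid on $E_1\oplus E_2$ whose independent spaces are exactly the $I\le E_1\oplus E_2$ with $\pi_1(I\cap\iota_1(E_1))$ independent in $M_1$ and $\lambda_1(\pi_1(I\cap\iota_1(E_1)))\ge\nu_2(\pi_2(I))$. *)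

theory Defs
  imports "HOL-Analysis.Product_Vector" "HOL-Library.FuncSet"
begin

(* The scalar field is F_q, i.e. an arbitrary finite field 'k.  The ground space E is the
   carrier type 'e, with F_q-structure given by scale.  A rank function is a function on the
   lattice of subspaces only, so it is required to be extensional there; two q-matroids on
   the same ground space are then equal iff their rank functions are equal. *)

locale q_matroid = vector_space scale
  for scale :: "'k::{field, finite} \<Rightarrow> 'e::ab_group_add \<Rightarrow> 'e" +
  fixes r :: "'e set \<Rightarrow> int"
  assumes finite_dimensional: "\<exists>B. finite_dimensional_vector_space scale B"
    and rank_extensional: "r \<in> extensional {A. subspace A}"
    and R1: "subspace A \<Longrightarrow> 0 \<le> r A \<and> r A \<le> int (dim A)"
    and R2: "subspace A \<Longrightarrow> subspace B \<Longrightarrow> A \<subseteq> B \<Longrightarrow> r A \<le> r B"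
    and R3: "subspace A \<Longrightarrow> subspace B \<Longrightarrow>
               r {x + y | x y. x \<in> A \<and> y \<in> B} + r (A \<inter> B) \<le> r A + r B"
begin

definition indep_space :: "'e set \<Rightarrow> bool"
  where "indep_space A \<longleftrightarrow> subspace A \<and> r A = int (dim A)"

(* lambda(A) = r(E) - r(A) *)
definition rank_lack :: "'e set \<Rightarrow> int"
  where "rank_lack A = r UNIV - r A"

definition nullity :: "'e set \<Rightarrow> int"
  where "nullity A = int (dim A) - r A"

end

abbreviation direct_sum ::
  "('k::field \<Rightarrow> 'a::ab_group_add \<Rightarrow> 'a) \<Rightarrow> ('k \<Rightarrow> 'b::ab_group_add \<Rightarrow> 'b) \<Rightarrow>
   'k \<Rightarrow> 'a \<times> 'b \<Rightarrow> 'a \<times> 'b"  (infixr \<open>\<oplus>\<^sub>s\<close> 65)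
  where "s1 \<oplus>\<^sub>s s2 \<equiv> module_prod.scale s1 s2"

definition free_product_indep ::
  "('k::{field, finite} \<Rightarrow> 'a::ab_group_add \<Rightarrow> 'a) \<Rightarrow> ('a set \<Rightarrow> int) \<Rightarrow>
   ('k \<Rightarrow> 'b::ab_group_add \<Rightarrow> 'b) \<Rightarrow> ('b set \<Rightarrow> int) \<Rightarrow> ('a \<times> 'b) set \<Rightarrow> bool"
  where "free_product_indep s1 r1 s2 r2 I \<longleftrightarrow>
    module.subspace (s1 \<oplus>\<^sub>s s2) I \<and>
    (let I1 = fst ` (I \<inter> range (\<lambda>x. (x, 0))) in
       q_matroid.indep_space s1 r1 I1 \<and>
       q_matroid.rank_lack r1 I1 \<ge> q_matroid.nullity s2 r2 (snd ` I))"

(* The rank function of the q-matroid on the direct sum with the prescribed independent spaces;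
   see free_product_unique_exists for existence and uniqueness. *)
definition free_product ::
  "('k::{field, finite} \<Rightarrow> 'a::ab_group_add \<Rightarrow> 'a) \<Rightarrow> ('a set \<Rightarrow> int) \<Rightarrow>
   ('k \<Rightarrow> 'b::ab_group_add \<Rightarrow> 'b) \<Rightarrow> ('b set \<Rightarrow> int) \<Rightarrow> ('a \<times> 'b) set \<Rightarrow> int"
  where "free_product s1 r1 s2 r2 =
    (THE r. q_matroid (s1 \<oplus>\<^sub>s s2) r \<and>
       (\<forall>I. q_matroid.indep_space (s1 \<oplus>\<^sub>s s2) r I \<longleftrightarrow> free_product_indep s1 r1 s2 r2 I))"

definition assoc_sum :: "'a \<times> ('b \<times> 'c) \<Rightarrow> ('a \<times> 'b) \<times> 'c"
  where "assoc_sum = (\<lambda>(x, y, z). ((x, y), z))"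

lemma (in finite_dimensional_vector_space) subspace_extend_induct:
  assumes S: "subspace I" "subspace J" "I \<subseteq> J" and base: "P I"
    and step: "\<And>K x. subspace K \<Longrightarrow> I \<subseteq> K \<Longrightarrow> K \<subseteq> J \<Longrightarrow> x \<in> J \<Longrightarrow> x \<notin> K \<Longrightarrow> P K \<Longrightarrow>
                 P (span (insert x K))"
  shows "P J"
proof -
  have "P J" if "subspace K" "I \<subseteq> K" "K \<subseteq> J" "P K" for K
    using that
  proof (induction "dim J - dim K" arbitrary: K rule: less_induct)
    case less
    show ?case
    proof (cases "K = J")
      case True
      then show ?thesis using less.prems by simp
    next
      case False
      then obtain x where x: "x \<in> J" "x \<notin> K" using less.prems by blast
      have sub: "span (insert x K) \<subseteq> J"
        using x less.prems S by (intro span_minimal) auto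
      have d: "dim (span (insert x K)) = dim K + 1"
        using x less.prems by (simp add: dim_insert span_eq_iff[THEN iffD2])
      have "dim (span (insert x K)) \<le> dim J"
        using dim_subset[OF sub] .
      then show ?thesis
        using d sub less.prems step[of K x] x
        by (intro less.hyps[of "span (insert x K)"]) (auto intro: span_base)
    qed
  qed
  then show ?thesis using S base by blast
qed

context q_matroid
begin

lemma span_insert_sum:
  assumes "subspace K"
  shows "span (insert x K) = {a + b | a b. a \<in> K \<and> b \<in> span {x}}"
  using span_Un[of K "{x}"] assms by (simp add: span_eq_iff[THEN iffD2])

lemma rank_insert_le:
  assumes K: "subspace K"
  shows "r (span (insert x K)) \<le> r K + 1"
proof -
  obtain B where "finite_dimensional_vector_space scale B" using finite_dimensional by blast
  then interpret fd: finite_dimensional_vector_space scale B .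
  have "r (span (insert x K)) + r (K \<inter> span {x}) \<le> r K + r (span {x})"
    unfolding span_insert_sum[OF K] using R3[OF K subspace_span] .
  moreover have "0 \<le> r (K \<inter> span {x})" using R1 K by (simp add: subspace_inter)
  moreover have "r (span {x}) \<le> int (dim (span {x}))" using R1[OF subspace_span] by blast
  moreover have "dim (span {x}) \<le> 1" by (simp only: dim_span fd.dim_singleton) simp
  ultimately show ?thesis by linarith
qed

lemma nullity_mono:
  assumes "subspace I" "subspace J" "I \<subseteq> J"
  shows "nullity I \<le> nullity J"
proof -
  obtain B where "finite_dimensional_vector_space scale B" using finite_dimensional by blast
  then interpret fd: finite_dimensional_vector_space scale B .
  show ?thesis
  proof (rule fd.subspace_extend_induct[OF assms])
    fix K x assume K: "subspace K" "x \<notin> K" "nullity I \<le> nullity K"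
    have "dim (span (insert x K)) = dim K + 1"
      using K by (simp add: fd.dim_insert span_eq_iff[THEN iffD2])
    then show "nullity I \<le> nullity (span (insert x K))"
      using K rank_insert_le[of K x] by (simp add: nullity_def)
  qed simp
qed

lemma indep_rank_attained:
  assumes A: "subspace A"
  shows "\<exists>I. I \<subseteq> A \<and> indep_space I \<and> r I = r A"
proof -
  obtain B where "finite_dimensional_vector_space scale B" using finite_dimensional by blast
  then interpret fd: finite_dimensional_vector_space scale B .
  have "indep_space {0} \<and> {0} \<subseteq> A"
    using R1[of "{0}"] A by (auto simp: indep_space_def subspace_0)
  then have "\<exists>I. (indep_space I \<and> I \<subseteq> A) \<and>
                 (\<forall>J. indep_space J \<and> J \<subseteq> A \<longrightarrow> dim J \<le> dim I)"
    by (rule ex_has_greatest_nat[where b = "dim A + 1"]) (auto simp: less_Suc_eq_le fd.dim_subset)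
  then obtain I where I: "indep_space I" "I \<subseteq> A"
    and max: "\<And>J. indep_space J \<Longrightarrow> J \<subseteq> A \<Longrightarrow> dim J \<le> dim I" by blast
  have sI: "subspace I" and rI: "r I = int (dim I)" using I by (auto simp: indep_space_def)
  have "r A = r I"
  proof (rule fd.subspace_extend_induct[OF sI A I(2)])
    fix K x assume K: "subspace K" "I \<subseteq> K" "K \<subseteq> A" "x \<in> A" "x \<notin> K" "r K = r I"
    let ?J = "span (insert x I)"
    have xI: "x \<notin> I" using K by blast
    have dJ: "dim ?J = dim I + 1"
      using xI sI by (simp add: fd.dim_insert span_eq_iff[THEN iffD2])
    have JA: "?J \<subseteq> A" using K I A by (intro span_minimal) auto
    have "\<not> indep_space ?J" using max[OF _ JA] dJ by auto
    then have "r ?J \<noteq> r I + 1" using dJ rI by (auto simp: indep_space_def)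
    then have rJ: "r ?J \<le> r I" using rank_insert_le[OF sI, of x] by linarith
    have eq: "{a + b | a b. a \<in> K \<and> b \<in> ?J} = span (insert x K)"
    proof -
      have "{a + b | a b. a \<in> K \<and> b \<in> ?J} = span (K \<union> insert x I)"
        using span_Un[of K "insert x I"] K(1) by (simp add: span_eq_iff[THEN iffD2])
      also have "K \<union> insert x I = insert x K" using K(2) by blast
      finally show ?thesis .
    qed
    have "r (span (insert x K)) + r (K \<inter> ?J) \<le> r K + r ?J"
      using R3[OF K(1) subspace_span[of "insert x I"]] unfolding eq .
    moreover have "r I \<le> r (K \<inter> ?J)"
      using K(1,2) sI by (intro R2) (auto intro: span_base subspace_inter)
    moreover have "r K \<le> r (span (insert x K))"
      using K(1) by (intro R2) (auto intro: span_base)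
    ultimately show "r (span (insert x K)) = r I" using rJ K(6) by linarith
  qed simp
  then show ?thesis using I by auto
qed

end

lemma q_matroid_eqI:
  assumes "q_matroid s r" "q_matroid s r'"
    and eq: "\<And>I. q_matroid.indep_space s r I \<longleftrightarrow> q_matroid.indep_space s r' I"
  shows "r = r'"
proof -
  interpret m: q_matroid s r by fact
  interpret m': q_matroid s r' by fact
  have "r A = r' A" if A: "m.subspace A" for A
  proof (rule antisym)
    obtain I where I: "I \<subseteq> A" "m.indep_space I" "r I = r A"
      using m.indep_rank_attained[OF A] by blast
    then show "r A \<le> r' A"
      using eq[of I] m'.R2[of I A] A by (simp add: m.indep_space_def m'.indep_space_def)
    obtain I where I: "I \<subseteq> A" "m'.indep_space I" "r' I = r' A"
      using m'.indep_rank_attained[OF A] by blast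
    then show "r' A \<le> r A"
      using eq[of I] m.R2[of I A] A by (simp add: m.indep_space_def m'.indep_space_def)
  qed
  then show ?thesis
    using m.rank_extensional m'.rank_extensional by (intro extensionalityI) auto
qed

(* The rank function of the free product is
   A |-> min (r1(A1) + dim(pi2 A)) (r1(E1) + r2(pi2 A)) with A1 = pi1(A \<inter> iota1 E1). *)
lemma free_product_exists:
  fixes s1 :: "'k::{field, finite} \<Rightarrow> 'a::ab_group_add \<Rightarrow> 'a" and r1 :: "'a set \<Rightarrow> int"
    and s2 :: "'k \<Rightarrow> 'b::ab_group_add \<Rightarrow> 'b" and r2 :: "'b set \<Rightarrow> int"
  assumes "q_matroid s1 r1" "q_matroid s2 r2"
  shows "\<exists>r. q_matroid (s1 \<oplus>\<^sub>s s2) r \<and>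
    (\<forall>I. q_matroid.indep_space (s1 \<oplus>\<^sub>s s2) r I \<longleftrightarrow> free_product_indep s1 r1 s2 r2 I)"
proof -
  interpret m1: q_matroid s1 r1 by fact
  interpret m2: q_matroid s2 r2 by fact
  obtain B1 where "finite_dimensional_vector_space s1 B1" using m1.finite_dimensional by blast
  then interpret f1: finite_dimensional_vector_space s1 B1 .
  obtain B2 where "finite_dimensional_vector_space s2 B2" using m2.finite_dimensional by blast
  then interpret f2: finite_dimensional_vector_space s2 B2 .
  interpret P: finite_dimensional_vector_space_prod s1 s2 B1 B2 by unfold_locales
  let ?E1 = "range (\<lambda>x::'a. (x, 0::'b))"
  let ?p1 = "\<lambda>A :: ('a \<times> 'b) set. fst ` (A \<inter> ?E1)"
  let ?S = "\<lambda>(A :: ('a \<times> 'b) set) B. {x + y | x y. x \<in> A \<and> y \<in> B}"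
  interpret l1: Vector_Spaces.linear s1 "s1 \<oplus>\<^sub>s s2" "\<lambda>x. (x, 0)"
    by unfold_locales (auto simp: P.scale_def)
  interpret fst: Vector_Spaces.linear "s1 \<oplus>\<^sub>s s2" s1 fst by (rule P.linear_fst)
  interpret snd: Vector_Spaces.linear "s1 \<oplus>\<^sub>s s2" s2 snd by (rule P.linear_snd)
  interpret pr: finite_dimensional_vector_space_pair s1 B1 "s1 \<oplus>\<^sub>s s2" P.Basis_pair
    by unfold_locales
  have E1: "P.p.subspace ?E1" using l1.subspace_image[OF m1.subspace_UNIV] .
  have s1: "m1.subspace (?p1 A)" if "P.p.subspace A" for A
    using that E1 by (intro fst.subspace_image P.p.subspace_inter)
  have s2: "m2.subspace (snd ` A)" if "P.p.subspace A" for A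
    using that by (intro snd.subspace_image)
  have p1_eq: "?p1 A = {x. (x, 0) \<in> A}" for A :: "('a \<times> 'b) set" by force
  have dimA: "P.p.dim A = m1.dim (?p1 A) + m2.dim (snd ` A)" if A: "P.p.subspace A" for A
  proof -
    have "A \<inter> ?E1 = (\<lambda>x. (x, 0)) ` ?p1 A" by force
    then have i: "P.p.dim (A \<inter> ?E1) = m1.dim (?p1 A)"
      using pr.dim_image_eq[OF l1.linear_axioms, of "?p1 A"] by (simp add: inj_on_def)
    have e: "P.p.dim ?E1 = m1.dim UNIV"
      using pr.dim_image_eq[OF l1.linear_axioms, of UNIV] by (simp add: inj_on_def)
    have "?S A ?E1 = UNIV \<times> snd ` A"
    proof (intro equalityI subsetI)
      fix z :: "'a \<times> 'b" assume "z \<in> UNIV \<times> snd ` A"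
      then obtain a where a: "a \<in> A" "snd z = snd a" by auto
      then have "z = a + (fst z - fst a, 0)" by (simp add: prod_eq_iff)
      then show "z \<in> ?S A ?E1" using a by blast
    qed force
    then have "P.p.dim (?S A ?E1) = m1.dim UNIV + m2.dim (snd ` A)"
      using P.dim_Times[OF m1.subspace_UNIV s2[OF A]] by simp
    then show ?thesis using P.p.dim_sums_Int[OF A E1] i e by linarith
  qed
  define f where "f A = r1 (?p1 A) + int (m2.dim (snd ` A))" for A
  define g where "g A = r1 UNIV + r2 (snd ` A)" for A :: "('a \<times> 'b) set"
  define r where "r = restrict (\<lambda>A. min (f A) (g A)) {A. P.p.subspace A}"
  have r_eq: "r A = min (f A) (g A)" if "P.p.subspace A" for A using that by (simp add: r_def)
  have f_eq: "f A = int (P.p.dim A) - m1.nullity (?p1 A)" if "P.p.subspace A" for A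
    using dimA[OF that] by (simp add: f_def m1.nullity_def)
  have f_sub: "f (?S A B) + f (A \<inter> B) \<le> f A + f B"
    if A: "P.p.subspace A" and B: "P.p.subspace B" for A B
  proof -
    have AB: "P.p.subspace (?S A B)" "P.p.subspace (A \<inter> B)"
      by (rule P.p.subspace_sums[OF A B], rule P.p.subspace_inter[OF A B])
    have i: "?p1 (A \<inter> B) = ?p1 A \<inter> ?p1 B" unfolding p1_eq by blast
    have S1: "m1.subspace {x + y | x y. x \<in> ?p1 A \<and> y \<in> ?p1 B}"
      using s1 A B by (intro m1.subspace_sums)
    have "{x + y | x y. x \<in> ?p1 A \<and> y \<in> ?p1 B} \<subseteq> ?p1 (?S A B)"
      unfolding p1_eq by force
    then have "m1.nullity {x + y | x y. x \<in> ?p1 A \<and> y \<in> ?p1 B} \<le> m1.nullity (?p1 (?S A B))"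
      using S1 s1[OF AB(1)] by (intro m1.nullity_mono)
    moreover have "m1.nullity (?p1 A) + m1.nullity (?p1 B) \<le>
        m1.nullity {x + y | x y. x \<in> ?p1 A \<and> y \<in> ?p1 B} + m1.nullity (?p1 (A \<inter> B))"
      using m1.R3[OF s1[OF A] s1[OF B]] f1.dim_sums_Int[OF s1[OF A] s1[OF B]]
      unfolding m1.nullity_def i by linarith
    ultimately show ?thesis
      using P.p.dim_sums_Int[OF A B] unfolding f_eq[OF A] f_eq[OF B] f_eq[OF AB(1)] f_eq[OF AB(2)]
      by linarith
  qed
  have snd_sum: "snd ` ?S A B = {x + y | x y. x \<in> snd ` A \<and> y \<in> snd ` B}"
    for A B :: "('a \<times> 'b) set"
  proof (intro equalityI subsetI)
    fix z assume "z \<in> {x + y | x y. x \<in> snd ` A \<and> y \<in> snd ` B}"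
    then obtain a b where "a \<in> A" "b \<in> B" "z = snd (a + b)" by auto
    then show "z \<in> snd ` ?S A B" by blast
  qed force
  have snd_int: "snd ` (A \<inter> B) \<subseteq> snd ` A \<inter> snd ` B" for A B :: "('a \<times> 'b) set" by blast
  have g_sub: "g (?S A B) + g (A \<inter> B) \<le> g A + g B"
    if A: "P.p.subspace A" and B: "P.p.subspace B" for A B
  proof -
    have "r2 (snd ` (A \<inter> B)) \<le> r2 (snd ` A \<inter> snd ` B)"
      using A B s2 by (intro m2.R2 snd_int m2.subspace_inter) (auto intro: P.p.subspace_inter)
    then show ?thesis
      using m2.R3[OF s2[OF A] s2[OF B]] unfolding g_def snd_sum by linarith
  qed
  have fg_sub: "g (?S A B) + f (A \<inter> B) \<le> f A + g B"
    if A: "P.p.subspace A" and B: "P.p.subspace B" for A B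
  proof -
    have AB: "P.p.subspace (?S A B)" "P.p.subspace (A \<inter> B)"
      by (rule P.p.subspace_sums[OF A B], rule P.p.subspace_inter[OF A B])
    have "r1 (?p1 (A \<inter> B)) \<le> r1 (?p1 A)"
      using s1[OF A] s1[OF AB(2)] by (intro m1.R2) auto
    moreover have "m2.dim (snd ` (A \<inter> B)) \<le> m2.dim (snd ` A \<inter> snd ` B)"
      by (intro f2.dim_subset snd_int)
    moreover have "m2.nullity (snd ` B) \<le> m2.nullity (snd ` ?S A B)"
    proof (intro m2.nullity_mono s2 B AB)
      show "snd ` B \<subseteq> snd ` ?S A B"
        unfolding snd_sum using m2.subspace_0[OF s2[OF A]] by force
    qed
    moreover have "int (m2.dim (snd ` ?S A B)) + int (m2.dim (snd ` A \<inter> snd ` B)) =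
        int (m2.dim (snd ` A)) + int (m2.dim (snd ` B))"
      using f2.dim_sums_Int[OF s2[OF A] s2[OF B]] unfolding snd_sum by linarith
    ultimately show ?thesis unfolding f_def g_def m2.nullity_def by linarith
  qed
  have S_comm: "?S A B = ?S B A" for A B :: "('a \<times> 'b) set"
    by (auto; metis add.commute)
  have q: "q_matroid (s1 \<oplus>\<^sub>s s2) r"
  proof
    show "\<exists>B. finite_dimensional_vector_space (s1 \<oplus>\<^sub>s s2) B"
      using P.p.finite_dimensional_vector_space_axioms by blast
    show "r \<in> extensional {A. P.p.subspace A}" by (simp add: r_def)
  next
    fix A assume A: "P.p.subspace A"
    have "0 \<le> r1 UNIV" using m1.R1[of UNIV] by simp
    then show "0 \<le> r A \<and> r A \<le> int (P.p.dim A)"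
      using m1.R1[OF s1[OF A]] m2.R1[OF s2[OF A]] dimA[OF A]
      by (auto simp: r_eq[OF A] f_def g_def)
  next
    fix A B assume AB: "P.p.subspace A" "P.p.subspace B" "A \<subseteq> B"
    have "r1 (?p1 A) \<le> r1 (?p1 B)" using AB s1 by (intro m1.R2) auto
    moreover have "r2 (snd ` A) \<le> r2 (snd ` B)" using AB s2 by (intro m2.R2) auto
    moreover have "m2.dim (snd ` A) \<le> m2.dim (snd ` B)"
      using AB by (intro f2.dim_subset) auto
    ultimately show "r A \<le> r B" using AB by (simp add: r_eq f_def g_def min_def)
  next
    fix A B assume AB: "P.p.subspace A" "P.p.subspace B"
    show "r (?S A B) + r (A \<inter> B) \<le> r A + r B"
      using f_sub[OF AB] g_sub[OF AB] fg_sub[OF AB] fg_sub[OF AB(2,1)] AB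
      unfolding S_comm[of B A] Int_commute[of B A]
      unfolding r_eq[OF AB(1)] r_eq[OF AB(2)] r_eq[OF P.p.subspace_sums[OF AB]]
        r_eq[OF P.p.subspace_inter[OF AB]] by linarith
  qed
  have "q_matroid.indep_space (s1 \<oplus>\<^sub>s s2) r I \<longleftrightarrow> free_product_indep s1 r1 s2 r2 I" for I
  proof (cases "P.p.subspace I")
    case True
    then show ?thesis
      using dimA[OF True] m1.R1[OF s1[OF True]] m2.R1[OF s2[OF True]] s1[OF True]
      by (auto simp: q_matroid.indep_space_def[OF q] free_product_indep_def Let_def
          m1.indep_space_def m1.rank_lack_def m2.nullity_def r_eq f_def g_def min_def)
  next
    case False
    then show ?thesis by (simp add: q_matroid.indep_space_def[OF q] free_product_indep_def)
  qed
  then show ?thesis using q by blast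
qed

lemma free_product_unique_exists:
  assumes "q_matroid s1 r1" "q_matroid s2 r2"
  shows "\<exists>!r. q_matroid (s1 \<oplus>\<^sub>s s2) r \<and>
    (\<forall>I. q_matroid.indep_space (s1 \<oplus>\<^sub>s s2) r I \<longleftrightarrow> free_product_indep s1 r1 s2 r2 I)"
proof -
  obtain r where r: "q_matroid (s1 \<oplus>\<^sub>s s2) r"
    "\<forall>I. q_matroid.indep_space (s1 \<oplus>\<^sub>s s2) r I \<longleftrightarrow> free_product_indep s1 r1 s2 r2 I"
    using free_product_exists[OF assms] by blast
  show ?thesis
  proof (rule ex1I[of _ r])
    show "q_matroid (s1 \<oplus>\<^sub>s s2) r \<and>
      (\<forall>I. q_matroid.indep_space (s1 \<oplus>\<^sub>s s2) r I \<longleftrightarrow> free_product_indep s1 r1 s2 r2 I)"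
      using r by blast
  next
    fix r' assume "q_matroid (s1 \<oplus>\<^sub>s s2) r' \<and>
      (\<forall>I. q_matroid.indep_space (s1 \<oplus>\<^sub>s s2) r' I \<longleftrightarrow> free_product_indep s1 r1 s2 r2 I)"
    then show "r' = r" using r by (intro q_matroid_eqI[of "s1 \<oplus>\<^sub>s s2"]) auto
  qed
qed

lemma
  assumes "q_matroid s1 r1" "q_matroid s2 r2"
  shows q_matroid_free_product: "q_matroid (s1 \<oplus>\<^sub>s s2) (free_product s1 r1 s2 r2)"
    and indep_space_free_product:
      "q_matroid.indep_space (s1 \<oplus>\<^sub>s s2) (free_product s1 r1 s2 r2) I \<longleftrightarrow>
       free_product_indep s1 r1 s2 r2 I"
  using theI'[OF free_product_unique_exists[OF assms]] by (auto simp: free_product_def)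

end

theory Submission
  imports Defs
begin

(* Write A1 for the fibre {x. (x, 0) \<in> A} and A2 for snd ` A.  The rank function of the free product
   is A |-> min (r1 A1 + dim A2) (r1 E1 + r2 A2).  Substituting this formula into itself, both
   bracketings become the minimum of the same three terms, because
   dim A2 = dim {y. (y, 0) \<in> A2} + dim (snd ` A2). *)

lemma fst_image_fibre: "fst ` (A \<inter> range (\<lambda>x. (x, 0))) = {x. (x, 0) \<in> A}"
  by force

context finite_dimensional_vector_space_prod
begin

lemma subspace_fibre: "p.subspace A \<Longrightarrow> vs1.subspace {x. (x, 0) \<in> A}"
  using p.subspace_0 p.subspace_add p.subspace_scale
  unfolding vs1.subspace_def by (fastforce simp: zero_prod_def scale_def)

lemma subspace_snd_image: "p.subspace A \<Longrightarrow> vs2.subspace (snd ` A)"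
proof -
  interpret snd: Vector_Spaces.linear scale s2 snd by (rule linear_snd)
  show "p.subspace A \<Longrightarrow> vs2.subspace (snd ` A)" by (rule snd.subspace_image)
qed

lemma subspace_with_fibre_and_image:
  assumes A: "p.subspace A"
    and U: "vs1.subspace U" "U \<subseteq> {x. (x, 0) \<in> A}"
    and W: "vs2.subspace W" "W \<subseteq> snd ` A"
  obtains I where "p.subspace I" "I \<subseteq> A" "{x. (x, 0) \<in> I} = U" "snd ` I = W"
    "p.dim I = vs1.dim U + vs2.dim W"
proof -
  interpret sp: finite_dimensional_vector_space_pair scale Basis_pair s2 B2 by unfold_locales
  interpret pp: finite_dimensional_vector_space_pair scale Basis_pair scale Basis_pair
    by unfold_locales
  obtain h where h: "range h \<subseteq> A" "Vector_Spaces.linear s2 scale h"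
    and hs: "\<And>w. w \<in> snd ` A \<Longrightarrow> snd (h w) = w"
    using sp.linear_exists_right_inverse_on[OF linear_snd A] by blast
  interpret h: Vector_Spaces.linear s2 scale h by fact
  define \<phi> where "\<phi> z = (fst z, 0) + h (snd z)" for z
  interpret \<phi>: Vector_Spaces.linear scale scale \<phi>
  proof unfold_locales
    fix a b :: "'b \<times> 'c" and c
    show "\<phi> (a + b) = \<phi> a + \<phi> b"
      by (simp add: \<phi>_def h.add prod_eq_iff algebra_simps)
    show "\<phi> (scale c a) = scale c (\<phi> a)"
      unfolding \<phi>_def p.scale_right_distrib h.scale[symmetric] by (simp add: scale_def)
  qed
  have \<phi>s: "snd (\<phi> (u, w)) = w" if "w \<in> snd ` A" for u w
    using hs[OF that] by (simp add: \<phi>_def)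
  have UW: "p.subspace (U \<times> W)" using U W by (intro subspace_Times)
  have "inj_on \<phi> (U \<times> W)"
  proof (rule inj_onI)
    fix a b assume ab: "a \<in> U \<times> W" "b \<in> U \<times> W" "\<phi> a = \<phi> b"
    then have "snd a \<in> snd ` A" "snd b \<in> snd ` A" using W by auto
    then have "snd a = snd b"
      using \<phi>s[of "snd a" "fst a"] \<phi>s[of "snd b" "fst b"] ab(3) by simp
    then show "a = b" using ab(3) by (simp add: \<phi>_def prod_eq_iff)
  qed
  then have d: "p.dim (\<phi> ` (U \<times> W)) = vs1.dim U + vs2.dim W"
    using pp.dim_image_eq[OF \<phi>.linear_axioms, of "U \<times> W"] UW U W
    by (simp add: p.span_eq_iff[THEN iffD2] dim_Times)
  have s: "snd ` \<phi> ` (U \<times> W) = W"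
  proof (intro equalityI subsetI)
    fix w assume "w \<in> snd ` \<phi> ` (U \<times> W)"
    then obtain u w' where "w' \<in> W" "w = snd (\<phi> (u, w'))" by auto
    then show "w \<in> W" using \<phi>s[of w' u] W(2) by (simp add: subset_iff)
  next
    fix w assume "w \<in> W"
    then have "snd (\<phi> (0, w)) = w" "(0, w) \<in> U \<times> W"
      using \<phi>s[of w 0] W(2) vs1.subspace_0[OF U(1)] by (simp_all add: subset_iff)
    then show "w \<in> snd ` \<phi> ` (U \<times> W)" by (metis imageI)
  qed
  have f: "{x. (x, 0) \<in> \<phi> ` (U \<times> W)} = U"
  proof (intro equalityI subsetI)
    fix x assume "x \<in> {x. (x, 0) \<in> \<phi> ` (U \<times> W)}"
    then obtain u w where uw: "u \<in> U" "w \<in> W" "(x, 0) = \<phi> (u, w)" by auto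
    then have "w = 0" using \<phi>s[of w u] W by (metis snd_conv subsetD)
    then show "x \<in> U" using uw by (simp add: \<phi>_def h.zero)
  next
    fix x assume "x \<in> U"
    moreover have "(x, 0) = \<phi> (x, 0)" by (simp add: \<phi>_def h.zero)
    ultimately show "x \<in> {x. (x, 0) \<in> \<phi> ` (U \<times> W)}"
      using vs2.subspace_0[OF W(1)] by blast
  qed
  have "\<phi> ` (U \<times> W) \<subseteq> A"
  proof
    fix a assume "a \<in> \<phi> ` (U \<times> W)"
    then obtain u w where uw: "u \<in> U" "a = (u, 0) + h w" by (auto simp: \<phi>_def)
    moreover have "(u, 0) \<in> A" "h w \<in> A" using uw U(2) h(1) by blast+
    ultimately show "a \<in> A" using p.subspace_add[OF A] by simp
  qed
  then show thesis using \<phi>.subspace_image[OF UW] f s d by (intro that)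
qed

text \<open>This is rank-nullity for \<open>snd\<close> on \<open>A\<close>: taking the whole fibre
  and the whole image in the previous construction gives a subspace of \<open>A\<close> that already
  fills \<open>A\<close>.\<close>

lemma dim_eq_fibre_plus_image:
  assumes A: "p.subspace A"
  shows "p.dim A = vs1.dim {x. (x, 0) \<in> A} + vs2.dim (snd ` A)"
proof -
  obtain I where I: "p.subspace I" "I \<subseteq> A" "{x. (x, 0) \<in> I} = {x. (x, 0) \<in> A}" "snd ` I = snd ` A"
    "p.dim I = vs1.dim {x. (x, 0) \<in> A} + vs2.dim (snd ` A)"
    using subspace_with_fibre_and_image[OF A subspace_fibre[OF A] _ subspace_snd_image[OF A]] by blast
  \<comment> \<open>An element of \<open>A\<close> differs from one of \<open>I\<close> with the
    same second component by a vector \<open>(x, 0)\<close> of \<open>A\<close>, and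
    \<open>I\<close> has the same fibre as \<open>A\<close>.\<close>
  have "A \<subseteq> I"
  proof
    fix a assume a: "a \<in> A"
    then obtain i where i: "i \<in> I" "snd i = snd a" using I(4) by (metis imageE imageI)
    have "a - i = (fst a - fst i, 0)" using i by (simp add: prod_eq_iff)
    moreover have "a - i \<in> A" using p.subspace_diff[OF A a] i(1) I(2) by blast
    ultimately have "fst a - fst i \<in> {x. (x, 0) \<in> I}" unfolding I(3) by simp
    then have "a - i \<in> I" using \<open>a - i = _\<close> by simp
    then show "a \<in> I" using p.subspace_add[OF I(1) _ i(1)] by fastforce
  qed
  then show ?thesis using I by (metis subset_antisym)
qed

end

text \<open>Growing \<open>I\<close> to \<open>J\<close> by one vector at a time raises the
  dimension by exactly one, so no intermediate value is skipped.\<close>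

lemma (in finite_dimensional_vector_space) subspace_intermediate_dim:
  assumes "subspace I" "subspace J" "I \<subseteq> J" "dim I \<le> n" "n \<le> dim J"
  obtains K where "subspace K" "I \<subseteq> K" "K \<subseteq> J" "dim K = n"
proof -
  have "\<forall>n. dim I \<le> n \<and> n \<le> dim J \<longrightarrow> (\<exists>K. subspace K \<and> I \<subseteq> K \<and> K \<subseteq> J \<and> dim K = n)"
  proof (rule subspace_extend_induct[OF assms(1-3)])
    show "\<forall>n. dim I \<le> n \<and> n \<le> dim I \<longrightarrow> (\<exists>K. subspace K \<and> I \<subseteq> K \<and> K \<subseteq> I \<and> dim K = n)"
      using assms(1) by auto
  next
    fix L x
    let ?L = "span (insert x L)"
    assume L: "subspace L" "I \<subseteq> L" "x \<notin> L"
      and IH: "\<forall>n. dim I \<le> n \<and> n \<le> dim L \<longrightarrow> (\<exists>K. subspace K \<and> I \<subseteq> K \<and> K \<subseteq> L \<and> dim K = n)"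
    have sub: "L \<subseteq> ?L" by (auto intro: span_base)
    have d: "dim ?L = dim L + 1" using L by (simp add: dim_insert span_eq_iff[THEN iffD2])
    show "\<forall>n. dim I \<le> n \<and> n \<le> dim ?L \<longrightarrow> (\<exists>K. subspace K \<and> I \<subseteq> K \<and> K \<subseteq> ?L \<and> dim K = n)"
    proof (intro allI impI)
      fix n assume n: "dim I \<le> n \<and> n \<le> dim ?L"
      show "\<exists>K. subspace K \<and> I \<subseteq> K \<and> K \<subseteq> ?L \<and> dim K = n"
      proof (cases "n \<le> dim L")
        case True
        then show ?thesis using IH n sub by (meson subset_trans)
      next
        \<comment> \<open>Here \<open>n\<close> must be \<open>dim L + 1\<close>, so the extended
          space itself is the witness.\<close>
        case False
        then have "dim ?L = n" using n d by linarith
        then show ?thesis using sub L(2) subspace_span by blast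
      qed
    qed
  qed
  then show thesis using assms(4,5) that by blast
qed

text \<open>An independent subspace of full rank in \<open>A\<close> has nullity 0. Enlarging it
  inside \<open>A\<close> cannot change the rank, so each new dimension adds one to the
  nullity.\<close>

lemma (in q_matroid) spanning_subspace_of_nullity:
  assumes A: "subspace A" and k: "0 \<le> k" "k \<le> nullity A"
  obtains J where "subspace J" "J \<subseteq> A" "r J = r A" "nullity J = k"
proof -
  obtain B where "finite_dimensional_vector_space scale B" using finite_dimensional by blast
  then interpret fd: finite_dimensional_vector_space scale B .
  obtain I where I: "I \<subseteq> A" "indep_space I" "r I = r A" using indep_rank_attained[OF A] by blast
  then have dI: "subspace I" "int (dim I) = r A" by (auto simp: indep_space_def)
  \<comment> \<open>Rank \<open>r A\<close> and nullity \<open>k\<close> force the dimension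
    \<open>r A + k\<close>; the bounds on \<open>k\<close> place it between \<open>dim I\<close> and
    \<open>dim A\<close>.\<close>
  obtain J where J: "subspace J" "I \<subseteq> J" "J \<subseteq> A" "dim J = nat (r A + k)"
    by (rule fd.subspace_intermediate_dim[OF dI(1) A I(1), of "nat (r A + k)"])
      (use dI k in \<open>auto simp: nullity_def\<close>)
  have "r J = r A" using R2[OF dI(1) J(1,2)] R2[OF J(1) A J(3)] I by linarith
  moreover have "0 \<le> r A" using R1[OF A] by blast
  ultimately show thesis using J k by (intro that[of J]) (simp_all add: nullity_def)
qed

text \<open>The rank of \<open>A\<close> is the largest dimension of an independent subspace of
  \<open>A\<close>. Any such subspace obeys both bounds in the minimum, and one that reaches the
  minimum is constructed.\<close>

lemma free_product_rank:
  fixes s1 :: "'k::{field, finite} \<Rightarrow> 'a::ab_group_add \<Rightarrow> 'a" and r1 :: "'a set \<Rightarrow> int"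
    and s2 :: "'k \<Rightarrow> 'b::ab_group_add \<Rightarrow> 'b" and r2 :: "'b set \<Rightarrow> int"
  assumes m1: "q_matroid s1 r1" and m2: "q_matroid s2 r2"
    and A: "module.subspace (s1 \<oplus>\<^sub>s s2) A"
  shows "free_product s1 r1 s2 r2 A =
    min (r1 {x. (x, 0) \<in> A} + int (vector_space.dim s2 (snd ` A))) (r1 UNIV + r2 (snd ` A))"
proof -
  interpret m1: q_matroid s1 r1 by fact
  interpret m2: q_matroid s2 r2 by fact
  obtain B1 where "finite_dimensional_vector_space s1 B1" using m1.finite_dimensional by blast
  then interpret f1: finite_dimensional_vector_space s1 B1 .
  obtain B2 where "finite_dimensional_vector_space s2 B2" using m2.finite_dimensional by blast
  then interpret f2: finite_dimensional_vector_space s2 B2 .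
  interpret P: finite_dimensional_vector_space_prod s1 s2 B1 B2 by unfold_locales
  define r where "r = free_product s1 r1 s2 r2"
  interpret m: q_matroid "s1 \<oplus>\<^sub>s s2" r
    unfolding r_def by (rule q_matroid_free_product[OF m1 m2])
  have indep: "m.indep_space I \<longleftrightarrow> P.p.subspace I \<and> m1.indep_space {x. (x, 0) \<in> I} \<and>
      m2.nullity (snd ` I) \<le> m1.rank_lack {x. (x, 0) \<in> I}" for I
    using indep_space_free_product[OF m1 m2, of I]
    unfolding free_product_indep_def Let_def fst_image_fibre r_def by blast
  note fibre = P.subspace_fibre[OF A] and image = P.subspace_snd_image[OF A]
  let ?f = "r1 {x. (x, 0) \<in> A} + int (m2.dim (snd ` A))" and ?g = "r1 UNIV + r2 (snd ` A)"
  have "r A \<le> min ?f ?g"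
  proof -
    obtain I where I: "I \<subseteq> A" "m.indep_space I" "r I = r A"
      using m.indep_rank_attained[OF A] by blast
    have sI: "P.p.subspace I" using I indep by blast
    note sI' = P.subspace_fibre[OF sI] P.subspace_snd_image[OF sI]
    have "r1 {x. (x, 0) \<in> I} \<le> r1 {x. (x, 0) \<in> A}"
      using I(1) sI'(1) fibre by (intro m1.R2) auto
    moreover have "r2 (snd ` I) \<le> r2 (snd ` A)"
      using I(1) sI'(2) image by (intro m2.R2) auto
    moreover have "m2.dim (snd ` I) \<le> m2.dim (snd ` A)"
      using I(1) by (intro f2.dim_subset) auto
    ultimately show ?thesis
      using I(2)[unfolded indep] I(2)[unfolded m.indep_space_def] I(3)
        P.dim_eq_fibre_plus_image[OF sI]
      by (auto simp: m1.indep_space_def m1.rank_lack_def m2.nullity_def)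
  qed
  moreover have "min ?f ?g \<le> r A"
  proof -
    \<comment> \<open>The image of an independent subspace should have as much nullity as both
      \<open>A\<close> and the rank lack of the fibre allow. Then
      \<open>dim U + dim W = r1 U + r2 W + k\<close>, which is \<open>?f\<close> or
      \<open>?g\<close> according to which term gives the minimum.\<close>
    define k where "k = min (m1.rank_lack {x. (x, 0) \<in> A}) (m2.nullity (snd ` A))"
    obtain U where U: "U \<subseteq> {x. (x, 0) \<in> A}" "m1.indep_space U" "r1 U = r1 {x. (x, 0) \<in> A}"
      using m1.indep_rank_attained[OF fibre] by blast
    have "0 \<le> k"
      using m1.R2[OF fibre m1.subspace_UNIV] m2.R1[OF image]
      by (simp add: k_def m1.rank_lack_def m2.nullity_def)
    then obtain W where W: "m2.subspace W" "W \<subseteq> snd ` A" "r2 W = r2 (snd ` A)" "m2.nullity W = k"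
      using m2.spanning_subspace_of_nullity[OF image, of k] by (auto simp: k_def)
    obtain I where I: "P.p.subspace I" "I \<subseteq> A" "{x. (x, 0) \<in> I} = U" "snd ` I = W"
      "P.p.dim I = m1.dim U + m2.dim W"
      using P.subspace_with_fibre_and_image[OF A _ U(1) W(1,2)] U(2)
      by (auto simp: m1.indep_space_def)
    have "m.indep_space I"
      unfolding indep I(3,4) using I(1) U W(4) by (simp add: k_def m1.rank_lack_def)
    then have "r I = int (m1.dim U) + int (m2.dim W)" using I(5) by (simp add: m.indep_space_def)
    moreover have "r I \<le> r A" using m.R2[OF I(1) A I(2)] .
    ultimately show ?thesis
      using U(2,3) W(3,4)
      by (auto simp: k_def m1.indep_space_def m1.rank_lack_def m2.nullity_def)
  qed
  ultimately show ?thesis unfolding r_def by (rule antisym)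
qed

text \<open>Agreement on subspaces is equality of q-matroids, since rank functions are extensional
  there and \<open>assoc_sum\<close> matches the subspaces of the two sums bijectively.\<close>

theorem proposition4p6:
  fixes s1 :: "'k::{field, finite} \<Rightarrow> 'a::ab_group_add \<Rightarrow> 'a"
    and s2 :: "'k \<Rightarrow> 'b::ab_group_add \<Rightarrow> 'b"
    and s3 :: "'k \<Rightarrow> 'c::ab_group_add \<Rightarrow> 'c"
    and r1 :: "'a set \<Rightarrow> int" and r2 :: "'b set \<Rightarrow> int" and r3 :: "'c set \<Rightarrow> int"
  assumes "q_matroid s1 r1" and "q_matroid s2 r2" and "q_matroid s3 r3"
  shows "\<forall>A. module.subspace (s1 \<oplus>\<^sub>s (s2 \<oplus>\<^sub>s s3)) A \<longrightarrow>
           free_product (s1 \<oplus>\<^sub>s s2) (free_product s1 r1 s2 r2) s3 r3 (assoc_sum ` A) =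
           free_product s1 r1 (s2 \<oplus>\<^sub>s s3) (free_product s2 r2 s3 r3) A"
proof (intro allI impI)
  fix A assume A: "module.subspace (s1 \<oplus>\<^sub>s (s2 \<oplus>\<^sub>s s3)) A"
  interpret m1: q_matroid s1 r1 by fact
  interpret m2: q_matroid s2 r2 by fact
  interpret m3: q_matroid s3 r3 by fact
  obtain B1 where "finite_dimensional_vector_space s1 B1" using m1.finite_dimensional by blast
  then interpret f1: finite_dimensional_vector_space s1 B1 .
  obtain B2 where "finite_dimensional_vector_space s2 B2" using m2.finite_dimensional by blast
  then interpret f2: finite_dimensional_vector_space s2 B2 .
  obtain B3 where "finite_dimensional_vector_space s3 B3" using m3.finite_dimensional by blast
  then interpret f3: finite_dimensional_vector_space s3 B3 .
  interpret P12: finite_dimensional_vector_space_prod s1 s2 B1 B2 by unfold_locales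
  interpret P23: finite_dimensional_vector_space_prod s2 s3 B2 B3 by unfold_locales
  interpret L: finite_dimensional_vector_space_prod "s1 \<oplus>\<^sub>s s2" s3 P12.Basis_pair B3
    by unfold_locales
  interpret R: finite_dimensional_vector_space_prod s1 "s2 \<oplus>\<^sub>s s3" B1 P23.Basis_pair
    by unfold_locales
  note m12 = q_matroid_free_product[OF assms(1,2)] and m23 = q_matroid_free_product[OF assms(2,3)]
  interpret assoc: Vector_Spaces.linear "s1 \<oplus>\<^sub>s (s2 \<oplus>\<^sub>s s3)" "(s1 \<oplus>\<^sub>s s2) \<oplus>\<^sub>s s3" assoc_sum
    by unfold_locales
      (auto simp: assoc_sum_def L.scale_def R.scale_def P12.scale_def P23.scale_def)
  have mem: "((x, y), z) \<in> assoc_sum ` A \<longleftrightarrow> (x, y, z) \<in> A" for x y z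
    by (force simp: assoc_sum_def)
  note sL = assoc.subspace_image[OF A]
  define C where "C = {w. (w, 0) \<in> assoc_sum ` A}"
  have sC: "P12.p.subspace C" unfolding C_def by (rule L.subspace_fibre[OF sL])
  have sB: "P23.p.subspace (snd ` A)" by (rule R.subspace_snd_image[OF A])
  have fibre_C: "{x. (x, 0) \<in> C} = {x. (x, 0) \<in> A}"
    by (simp add: C_def mem zero_prod_def)
  have snd_C: "snd ` C = {y. (y, 0) \<in> snd ` A}"
  proof (intro equalityI subsetI)
    fix y assume "y \<in> {y. (y, 0) \<in> snd ` A}"
    then obtain x where "(x, y, 0) \<in> A" by auto
    then have "(x, y) \<in> C" by (simp add: C_def mem)
    then show "y \<in> snd ` C" by force
  next
    fix y assume "y \<in> snd ` C"
    then obtain x where "(x, y) \<in> C" by auto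
    then have "(x, y, 0) \<in> A" unfolding C_def mem[symmetric] by simp
    then show "y \<in> {y. (y, 0) \<in> snd ` A}" by force
  qed
  have snd_A: "snd ` assoc_sum ` A = snd ` snd ` A"
    by (force simp: assoc_sum_def image_image)
  have r12: "free_product s1 r1 s2 r2 UNIV = r1 UNIV + r2 UNIV"
    using free_product_rank[OF assms(1,2) P12.p.subspace_UNIV] m2.R1[OF m2.subspace_UNIV]
    by (simp add: surj_def)
  show "free_product (s1 \<oplus>\<^sub>s s2) (free_product s1 r1 s2 r2) s3 r3 (assoc_sum ` A) =
        free_product s1 r1 (s2 \<oplus>\<^sub>s s3) (free_product s2 r2 s3 r3) A"
    unfolding free_product_rank[OF m12 assms(3) sL] free_product_rank[OF assms(1) m23 A]
      C_def[symmetric] free_product_rank[OF assms(1,2) sC] free_product_rank[OF assms(2,3) sB]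
      r12 fibre_C snd_C snd_A P23.dim_eq_fibre_plus_image[OF sB]
    by auto
qed

end
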